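(* Let $\gamma\in[0,1]$ and let $\chi_\gamma$ be the Choi matrix of the amplitude damping channel $\mathcal E_\gamma$. Using noisy teleportation over the resource state $\chi_\gamma$ (with arbitrary classical channel $\Pi$), it is only possible to simulate qubit channels of the form $$\sigma_x^{u}\circ\mathcal E_\eta\circ\mathcal E_P,\qquad u\in\{0,1\},$$ where $\eta\in[0,\gamma]$ and the Pauli channel $\mathcal E_P$ has parameters $\mathbf q=(q_1,q_2,q_3)$ belonging to the convex hull of the eight points $$(a,\pm ab,\mp a^2b),\quad(\pm ab,a,\mp a^2b),\quad(-a,\pm ab,\pm a^2b),\quad(\pm ab,-a,\pm a^2b),$$ with $$a=\sqrt{\frac{1-\gamma}{1-\eta}},\qquad b=1-\frac{\eta}{\gamma}.$$ These eight points correspond to the extremal points of the tetrahedron $\mathcal T$ truncated by the two planes $z=\pm b$ (i.e. of $\mathcal T\cap\{|z|\le b\}$), shrunk by the transformation $(x,y,z)\mapsto(ax,ay,a^2z)$.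
   Context: In each listed pair of points the upper signs go together and the lower signs go together. The formulas for $a$ and $b$ presuppose $\eta\ne1$ and $\gamma\neq0$. $(\sigma_0,\sigma_1,\sigma_2,\sigma_3)=(I,\sigma_x,\sigma_y,\sigma_z)$ are the Pauli matrices. The Bloch vector $(x,y,z)$ of a qubit state $\rho$ is defined by $\rho=\frac12(I+x\sigma_x+y\sigma_y+z\sigma_z)$, and qubit channels are described by their action on Bloch vectors. In compositions, $\sigma_x$ denotes the unitary channel $\rho\mapsto\sigma_x\rho\sigma_x^\dagger$. For $\gamma\in[0,1]$, the amplitude damping channel $\mathcal E_\gamma$ acts as $(x,y,z)\mapsto(\sqrt{1-\gamma}\,x,\sqrt{1-\gamma}\,y,\gamma+(1-\gamma)z)$. Its Choi matrix $\chi_\gamma=(\mathbb I\otimes\mathcal E_\gamma)(|\Phi\rangle\langle\Phi|)$, with $|\Phi\rangle=\frac1{\sqrt2}(|00\rangle+|11\rangle)$, is, in the basis $|00\rangle,|01\rangle,|10\rangle,|11\rangle$, $$\chi_\gamma=\begin{pmatrix}\frac12&0&0&\frac{\sqrt{1-\gamma}}2\\0&0&0&0\\0&0&\frac\gamma2&0\\\frac{\sqrt{1-\gamma}}2&0&0&\frac{1-\gamma}2\end{pmatrix}.$$ $\mathcal T$ is the tetrahedron with vertices $(1,-1,1),(1,1,-1),(-1,-1,-1),(-1,1,1)$ (convex hull). The Pauli channel with parameters $\mathbf q=(q_1,q_2,q_3)\in\mathcal T$ acts as $(x,y,z)\mapsto(q_1x,-q_2y,q_3z)$. Bell projectors: $E_0=|\Phi^+\rangle\langle\Phi^+|$,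 $E_1=|\Psi^+\rangle\langle\Psi^+|$, $E_2=|\Psi^-\rangle\langle\Psi^-|$, $E_3=|\Phi^-\rangle\langle\Phi^-|$, where $|\Phi^\pm\rangle=\frac1{\sqrt2}(|00\rangle\pm|11\rangle)$ and $|\Psi^\pm\rangle=\frac1{\sqrt2}(|01\rangle\pm|10\rangle)$. A classical channel is a family $\Pi=\{p_{l|k}\}_{k,l\in\{0,1,2,3\}}$ with $p_{l|k}\ge0$ and $\sum_lp_{l|k}=1$ for every $k$. The channel simulated by noisy teleportation over a two-qubit state $\tau_{AB}$ with classical channel $\Pi$ (Bell measurement $\{E_k\}$ on input qubit $C$ and $A$; on outcome $k$ Bob applies $\sigma_l$ to $B$ with probability $p_{l|k}$) is $$\rho\mapsto\sum_{k,l=0}^3 p_{l|k}\;\sigma_l\,\mathrm{Tr}_{CA}\big[(E_k)_{CA}(\rho_C\otimes\tau_{AB})\big]\,\sigma_l .$$ *)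

theory Defs
  imports "HOL-Analysis.Analysis"
begin

text \<open>
  Matrices are indexed by finite types. The index type of a qubit is \<open>2\<close>, with index \<open>1\<close>
  standing for the basis vector \<open>|0\<rangle>\<close> and index \<open>2\<close> for \<open>|1\<rangle>\<close>; the index type of a composite
  system is the product of the index types of its parts.
\<close>

type_synonym 'n cmat = "((complex, 'n) vec, 'n) vec"

definition cscale :: "complex \<Rightarrow> 'n::finite cmat \<Rightarrow> 'n cmat" (infixr "*\<^sub>C" 75) where
  "c *\<^sub>C A = (\<chi> i j. c * A $ i $ j)"

definition adjoint_mat :: "'n::finite cmat \<Rightarrow> 'n cmat" where
  "adjoint_mat A = (\<chi> i j. cnj (A $ j $ i))"

definition ket_bra :: "complex^'n::finite \<Rightarrow> complex^'n \<Rightarrow> 'n cmat" where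
  "ket_bra v w = (\<chi> i j. v $ i * cnj (w $ j))"

definition tensor_mat :: "'m::finite cmat \<Rightarrow> 'n::finite cmat \<Rightarrow> ('m \<times> 'n) cmat" where
  "tensor_mat A B = (\<chi> i j. A $ fst i $ fst j * B $ snd i $ snd j)"

fun pauli :: "nat \<Rightarrow> 2 cmat" where
  "pauli 0 = mat 1"
| "pauli (Suc 0) = vector [vector [0, 1], vector [1, 0]]"
| "pauli (Suc (Suc 0)) = vector [vector [0, -\<i>], vector [\<i>, 0]]"
| "pauli _ = vector [vector [1, 0], vector [0, -1]]"

definition bloch_state :: "real^3 \<Rightarrow> 2 cmat" where
  "bloch_state r =
     (1/2) *\<^sub>R (pauli 0 + (r$1) *\<^sub>R pauli 1 + (r$2) *\<^sub>R pauli 2 + (r$3) *\<^sub>R pauli 3)"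

text \<open>
  The complex-linear map on all 2-by-2 matrices induced by an affine map \<open>f\<close> of Bloch vectors.
  Since \<open>M = (1/2) (tr M I + (\<Sum>i. tr (\<sigma>\<^sub>i M) \<sigma>\<^sub>i))\<close>, \<open>I = 2 bloch_state 0\<close> and
  \<open>\<sigma>\<^sub>i = 2 (bloch_state e\<^sub>i - bloch_state 0)\<close>, it is determined by the images of \<open>0\<close> and of
  the unit vectors \<open>e\<^sub>i\<close>.
\<close>

definition bloch_channel :: "(real^3 \<Rightarrow> real^3) \<Rightarrow> 2 cmat \<Rightarrow> 2 cmat" where
  "bloch_channel f M =
     trace M *\<^sub>C bloch_state (f 0)
     + trace (pauli 1 ** M) *\<^sub>C (bloch_state (f (axis 1 1)) - bloch_state (f 0))
     + trace (pauli 2 ** M) *\<^sub>C (bloch_state (f (axis 2 1)) - bloch_state (f 0))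
     + trace (pauli 3 ** M) *\<^sub>C (bloch_state (f (axis 3 1)) - bloch_state (f 0))"

definition unitary_channel :: "'n::finite cmat \<Rightarrow> 'n cmat \<Rightarrow> 'n cmat" where
  "unitary_channel U M = U ** M ** adjoint_mat U"

definition amplitude_damping :: "real \<Rightarrow> 2 cmat \<Rightarrow> 2 cmat" where
  "amplitude_damping \<gamma> = bloch_channel
     (\<lambda>r. vector [sqrt (1 - \<gamma>) * r$1, sqrt (1 - \<gamma>) * r$2, \<gamma> + (1 - \<gamma>) * r$3])"

definition pauli_channel :: "real^3 \<Rightarrow> 2 cmat \<Rightarrow> 2 cmat" where
  "pauli_channel q = bloch_channel (\<lambda>r. vector [q$1 * r$1, - (q$2) * r$2, q$3 * r$3])"

definition tetrahedron :: "(real^3) set" where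
  "tetrahedron = convex hull
     {vector [1, -1, 1], vector [1, 1, -1], vector [-1, -1, -1], vector [-1, 1, 1]}"

fun bell_vec :: "nat \<Rightarrow> complex^(2 \<times> 2)" where
  "bell_vec 0 = (1 / sqrt 2) *\<^sub>R (axis (1, 1) 1 + axis (2, 2) 1)"
| "bell_vec (Suc 0) = (1 / sqrt 2) *\<^sub>R (axis (1, 2) 1 + axis (2, 1) 1)"
| "bell_vec (Suc (Suc 0)) = (1 / sqrt 2) *\<^sub>R (axis (1, 2) 1 - axis (2, 1) 1)"
| "bell_vec _ = (1 / sqrt 2) *\<^sub>R (axis (1, 1) 1 - axis (2, 2) 1)"

definition bell_proj :: "nat \<Rightarrow> (2 \<times> 2) cmat" where
  "bell_proj k = ket_bra (bell_vec k) (bell_vec k)"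

text \<open>
  \<open>id_tensor F\<close> is the map \<open>\<I> \<otimes> F\<close>: it applies \<open>F\<close> to each block of a block matrix whose blocks
  are indexed by the first factor.
\<close>

definition id_tensor ::
    "('n::finite cmat \<Rightarrow> 'n cmat) \<Rightarrow> ('m::finite \<times> 'n) cmat \<Rightarrow> ('m \<times> 'n) cmat" where
  "id_tensor F X =
     (\<chi> i j. F (\<chi> b b'. X $ (fst i, b) $ (fst j, b')) $ snd i $ snd j)"

definition choi :: "(2 cmat \<Rightarrow> 2 cmat) \<Rightarrow> (2 \<times> 2) cmat" where
  "choi F = id_tensor F (bell_proj 0)"

text \<open>
  Three-qubit systems \<open>CAB\<close> have index type \<open>2 \<times> (2 \<times> 2)\<close>; \<open>on_CA E\<close> is \<open>E \<otimes> I\<close> with \<open>E\<close>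
  acting on the first two qubits.
\<close>

definition on_CA :: "(2 \<times> 2) cmat \<Rightarrow> (2 \<times> (2 \<times> 2)) cmat" where
  "on_CA E = (\<chi> i j. case (i, j) of ((c, a, b), (c', a', b')) \<Rightarrow>
     E $ (c, a) $ (c', a') * (if b = b' then 1 else 0))"

definition trace_CA :: "(2 \<times> (2 \<times> 2)) cmat \<Rightarrow> 2 cmat" where
  "trace_CA M = (\<chi> b b'. \<Sum>c\<in>UNIV. \<Sum>a\<in>UNIV. M $ (c, a, b) $ (c, a, b'))"

text \<open>\<open>p l k\<close> is the probability of output \<open>l\<close> given input \<open>k\<close>.\<close>

definition classical_channel :: "(nat \<Rightarrow> nat \<Rightarrow> real) \<Rightarrow> bool" where
  "classical_channel p \<longleftrightarrow>
     (\<forall>k\<in>{0..3}. (\<forall>l\<in>{0..3}. 0 \<le> p l k) \<and> (\<Sum>l=0..3. p l k) = 1)"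

definition noisy_teleportation ::
    "(2 \<times> 2) cmat \<Rightarrow> (nat \<Rightarrow> nat \<Rightarrow> real) \<Rightarrow> 2 cmat \<Rightarrow> 2 cmat" where
  "noisy_teleportation \<tau> p \<rho> =
     (\<Sum>k=0..3. \<Sum>l=0..3.
        p l k *\<^sub>R (pauli l ** trace_CA (on_CA (bell_proj k) ** tensor_mat \<rho> \<tau>) ** pauli l))"

definition region_points :: "real \<Rightarrow> real \<Rightarrow> (real^3) set" where
  "region_points a b = (\<Union>s\<in>{1, -1}.
     {vector [a, s * (a * b), - s * (a\<^sup>2 * b)],
      vector [s * (a * b), a, - s * (a\<^sup>2 * b)],
      vector [- a, s * (a * b), s * (a\<^sup>2 * b)],
      vector [s * (a * b), - a, s * (a\<^sup>2 * b)]})"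

definition truncated_tetrahedron :: "real \<Rightarrow> (real^3) set" where
  "truncated_tetrahedron b = tetrahedron \<inter> {v. \<bar>v$3\<bar> \<le> b}"

definition shrink :: "real \<Rightarrow> real^3 \<Rightarrow> real^3" where
  "shrink a v = vector [a * v$1, a * v$2, a\<^sup>2 * v$3]"

text \<open>
  \<open>param_a\<close> is meaningful only for \<open>\<eta> \<noteq> 1\<close>, \<open>param_b\<close> only for \<open>\<gamma> \<noteq> 0\<close>; elsewhere division by
  zero makes their values arbitrary.
\<close>

definition param_a :: "real \<Rightarrow> real \<Rightarrow> real" where
  "param_a \<gamma> \<eta> = sqrt ((1 - \<gamma>) / (1 - \<eta>))"

definition param_b :: "real \<Rightarrow> real \<Rightarrow> real" where
  "param_b \<gamma> \<eta> = 1 - \<eta> / \<gamma>"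

lemmas mat2_simps = axis_def vec_eq_iff forall_2 sum_2 matrix_matrix_mult_def trace_def mat_def
  cscale_def numeral_2_eq_2 numeral_3_eq_3 complex_eq_iff

lemma bloch_channel_linear:
  "bloch_channel f (M + N) = bloch_channel f M + bloch_channel f N"
  "bloch_channel f (c *\<^sub>C M) = c *\<^sub>C bloch_channel f M"
  by (simp_all add: bloch_channel_def mat2_simps algebra_simps)

lemma amplitude_damping_bloch_state:
  "amplitude_damping \<gamma> (bloch_state r) =
     bloch_state (vector [sqrt (1 - \<gamma>) * r$1, sqrt (1 - \<gamma>) * r$2, \<gamma> + (1 - \<gamma>) * r$3])"
  by (simp add: amplitude_damping_def bloch_channel_def bloch_state_def mat2_simps algebra_simps)

lemma pauli_channel_bloch_state:
  "pauli_channel q (bloch_state r) = bloch_state (vector [q$1 * r$1, - (q$2) * r$2, q$3 * r$3])"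
  by (simp add: pauli_channel_def bloch_channel_def bloch_state_def mat2_simps algebra_simps)

lemma choi_amplitude_damping:
  "choi (amplitude_damping \<gamma>) =
     (1/2) *\<^sub>R ket_bra (axis (1, 1) 1) (axis (1, 1) 1)
     + (sqrt (1 - \<gamma>) / 2) *\<^sub>R
         (ket_bra (axis (1, 1) 1) (axis (2, 2) 1) + ket_bra (axis (2, 2) 1) (axis (1, 1) 1))
     + (\<gamma> / 2) *\<^sub>R ket_bra (axis (2, 1) 1) (axis (2, 1) 1)
     + ((1 - \<gamma>) / 2) *\<^sub>R ket_bra (axis (2, 2) 1) (axis (2, 2) 1)"
  by (simp add: choi_def id_tensor_def bell_proj_def ket_bra_def split_paired_All
      amplitude_damping_def bloch_channel_def bloch_state_def mat2_simps)

end

(* Each Bell outcome k contributes the channel amplitude_damping precomposed with the Pauli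
   unitary sigma_k, so the simulated channel is a mixture of sigma_l o E_gamma o sigma_k.  On Bloch
   vectors it scales the axes by (sqrt (1 - g) X, sqrt (1 - g) Y, (1 - g) Z) and shifts z by g W,
   where X, Y, Z, W are averages of products of signs with |Z| + |W| <= 1.  Taking eta = g |W| and
   u = 1 iff W < 0, the remaining Pauli channel is the shrunk point (X, -Y, Z) or (X, Y, -Z), and
   |Z| <= 1 - |W| = b is the truncation of the tetrahedron. *)

theory Submission
  imports Defs
begin

section \<open>The truncated tetrahedron\<close>

lemma vec3_eq_iff: "(v :: 'a^3) = w \<longleftrightarrow> v$1 = w$1 \<and> v$2 = w$2 \<and> v$3 = w$3"
  by (simp add: vec_eq_iff forall_3)

text \<open>The preimage of a convex set under an affine map of the real line is convex, so it is an
  interval. Stating this with a parameter \<open>t\<close> between \<open>lo\<close> and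
  \<open>hi\<close> lets the endpoints coincide without any division by \<open>hi - lo\<close>. That
  happens below for \<open>b = 0\<close>, and for slices at height 1 or -1.\<close>

lemma convex_line_mem:
  fixes d v :: "'a::real_vector"
  assumes "convex S" "v + lo *\<^sub>R d \<in> S" "v + hi *\<^sub>R d \<in> S" "lo \<le> t" "t \<le> hi"
  shows "v + t *\<^sub>R d \<in> S"
proof -
  have "convex {r. v + r *\<^sub>R d \<in> S}"
  proof (rule convexI)
    fix x y u w :: real
    assume "x \<in> {r. v + r *\<^sub>R d \<in> S}" "y \<in> {r. v + r *\<^sub>R d \<in> S}" "0 \<le> u" "0 \<le> w" "u + w = 1"
    then have "u *\<^sub>R (v + x *\<^sub>R d) + w *\<^sub>R (v + y *\<^sub>R d) \<in> S"
      using \<open>convex S\<close> by (auto intro: convexD)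
    moreover have "u *\<^sub>R (v + x *\<^sub>R d) + w *\<^sub>R (v + y *\<^sub>R d) =
        (u + w) *\<^sub>R v + (u * x + w * y) *\<^sub>R d"
      by (simp add: algebra_simps)
    ultimately show "u *\<^sub>R x + w *\<^sub>R y \<in> {r. v + r *\<^sub>R d \<in> S}"
      using \<open>u + w = 1\<close> by simp
  qed
  then have "closed_segment lo hi \<subseteq> {r. v + r *\<^sub>R d \<in> S}"
    using assms by (simp add: convex_contains_segment)
  then show ?thesis
    using assms by (auto simp: closed_segment_eq_real_ivl)
qed

text \<open>The four linear inequalities say that the four Pauli weights (1 + x - y + z)/4, (1 + x +
  y - z)/4, (1 - x - y - z)/4 and (1 - x + y + z)/4 are nonnegative. Each of them bounds one face of
  the tetrahedron.\<close>

definition pauli_facets :: "(real^3) set" where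
  "pauli_facets = {v. \<bar>v$1 + v$2\<bar> \<le> 1 - v$3 \<and> \<bar>v$1 - v$2\<bar> \<le> 1 + v$3}"

lemma region_points_one_subset:
  "region_points 1 b \<subseteq> S \<longleftrightarrow>
    vector [1, b, - b] \<in> S \<and> vector [1, - b, b] \<in> S \<and>
    vector [b, 1, - b] \<in> S \<and> vector [- b, 1, b] \<in> S \<and>
    vector [b, - 1, b] \<in> S \<and> vector [- b, - 1, - b] \<in> S \<and>
    vector [- 1, b, b] \<in> S \<and> vector [- 1, - b, - b] \<in> S"
  unfolding region_points_def by simp blast

text \<open>Both claims come from one identity: the hull of the eight points is the set cut out by
  the four facets and the two planes. At \<open>b = 1\<close> the eight points collapse to the four
  vertices, and the planes cut nothing off, because the facet inequalities already force
  \<bar>z\<bar> \<le> 1.\<close>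

lemma
  shows tetrahedron_eq_facets: "tetrahedron = pauli_facets"
    and truncated_tetrahedron_eq_hull:
      "\<And>b. 0 \<le> b \<Longrightarrow> b \<le> 1 \<Longrightarrow> truncated_tetrahedron b = convex hull region_points 1 b"
proof -
  have hull: "convex hull region_points 1 b = pauli_facets \<inter> {v. \<bar>v$3\<bar> \<le> b}" (is "?H = ?F")
    if "0 \<le> b" "b \<le> 1" for b
  proof
    have "convex ?F"
    proof -
      have "?F = {v. inner (vector [1, 1, 1]) v \<le> 1} \<inter> {v. inner (vector [-1, -1, 1]) v \<le> 1}
        \<inter> {v. inner (vector [1, -1, -1]) v \<le> 1} \<inter> {v. inner (vector [-1, 1, -1]) v \<le> 1}
        \<inter> {v. inner (vector [0, 0, 1]) v \<le> b} \<inter> {v. inner (vector [0, 0, -1]) v \<le> b}"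
        by (auto simp: pauli_facets_def inner_vec_def sum_3)
      then show ?thesis
        by (simp only:) (intro convex_Int convex_halfspace_le)
    qed
    moreover have "region_points 1 b \<subseteq> ?F"
      using that by (auto simp: region_points_def pauli_facets_def)
    ultimately show "?H \<subseteq> ?F"
      by (metis hull_minimal)
  next
    have line: "vector [x + t * k, y + t * l, z + t * m] \<in> ?H"
      if "vector [x + lo * k, y + lo * l, z + lo * m] \<in> ?H"
         "vector [x + hi * k, y + hi * l, z + hi * m] \<in> ?H" "lo \<le> t" "t \<le> hi"
      for x y z k l m lo hi t :: real
    proof -
      have eq: "vector [x + r * k, y + r * l, z + r * m] =
          vector [x, y, z] + r *\<^sub>R (vector [k, l, m] :: real^3)" for r
        by (simp add: vec3_eq_iff)
      show ?thesis
        unfolding eq by (rule convex_line_mem[OF convex_convex_hull that(1,2)[unfolded eq] that(3,4)])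
    qed
    show "?F \<subseteq> ?H"
    proof
      fix v assume "v \<in> ?F"
      define x y z where "x = v$1" and "y = v$2" and "z = v$3"
      have v: "v = vector [x, y, z]"
        by (simp add: vec3_eq_iff x_def y_def z_def)
      have z: "- b \<le> z" "z \<le> b" and F: "\<bar>x + y\<bar> \<le> 1 - z" "\<bar>x - y\<bar> \<le> 1 + z"
        using \<open>v \<in> ?F\<close> by (auto simp: pauli_facets_def x_def y_def z_def)
      have V: "vector [1, b, - b] \<in> ?H" "vector [1, - b, b] \<in> ?H"
          "vector [b, 1, - b] \<in> ?H" "vector [- b, 1, b] \<in> ?H"
          "vector [b, - 1, b] \<in> ?H" "vector [- b, - 1, - b] \<in> ?H"
          "vector [- 1, b, b] \<in> ?H" "vector [- 1, - b, - b] \<in> ?H"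
        using hull_subset[of "region_points 1 b" convex] unfolding region_points_one_subset by blast+
      \<comment> \<open>Four edges of the tetrahedron join its top edge to its bottom edge.
        Truncation keeps the part of each between heights -b and b, whose ends are two of the eight
        points; \<open>line\<close> with the height as parameter reaches height \<open>z\<close> on
        each.\<close>
      have corners: "vector [1, - z, z] \<in> ?H" "vector [- z, 1, z] \<in> ?H"
           "vector [z, - 1, z] \<in> ?H" "vector [- 1, z, z] \<in> ?H"
        using V z line[of 1 "- b" 0 0 "-1" 0 1 b z, simplified] line[of 0 "- b" "-1" 1 0 0 1 b z, simplified]
          line[of 0 "- b" 1 "-1" 0 0 1 b z, simplified] line[of "-1" "- b" 0 0 1 0 1 b z, simplified]
        by blast+
      \<comment> \<open>In the coordinates \<open>x + y\<close>, \<open>x - y\<close> the slice at height \<open>z\<close> is a rectangle.\<close>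
      define P :: "real \<Rightarrow> real \<Rightarrow> real^3" where "P p m = vector [(p + m) / 2, (p - m) / 2, z]" for p m
      \<comment> \<open>The point is rewritten as an affine function of one rectangle coordinate at
        a time, the shape that \<open>line\<close> expects. Filling the two opposite sides and then
        the segments between them covers the rectangle.\<close>
      have P_m: "P p m = vector [p / 2 + m * (1 / 2), p / 2 + m * (- 1 / 2), z + m * 0]" for p m
        by (simp add: P_def vec3_eq_iff field_simps)
      have P_p: "P p m = vector [m / 2 + p * (1 / 2), - m / 2 + p * (1 / 2), z + p * 0]" for p m
        by (simp add: P_def vec3_eq_iff field_simps)
      have along_m: "P p m \<in> ?H" if "P p lo \<in> ?H" "P p hi \<in> ?H" "lo \<le> m" "m \<le> hi" for p m lo hi
        using that unfolding P_m by (rule line)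
      have along_p: "P p m \<in> ?H" if "P lo m \<in> ?H" "P hi m \<in> ?H" "lo \<le> p" "p \<le> hi" for p m lo hi
        using that unfolding P_p by (rule line)
      have "P (1 - z) (1 + z) = vector [1, - z, z]" "P (1 - z) (- (1 + z)) = vector [- z, 1, z]"
          "P (- (1 - z)) (1 + z) = vector [z, - 1, z]" "P (- (1 - z)) (- (1 + z)) = vector [- 1, z, z]"
        by (simp_all add: P_def vec3_eq_iff)
      with corners have "P (1 - z) (1 + z) \<in> ?H" "P (1 - z) (- (1 + z)) \<in> ?H"
          "P (- (1 - z)) (1 + z) \<in> ?H" "P (- (1 - z)) (- (1 + z)) \<in> ?H"
        by (simp_all only:)
      moreover have "- (1 + z) \<le> x - y" "x - y \<le> 1 + z" "- (1 - z) \<le> x + y" "x + y \<le> 1 - z"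
        using F by linarith+
      ultimately have "P (x + y) (x - y) \<in> ?H"
        by (blast intro: along_m along_p)
      then show "v \<in> ?H"
        by (simp add: v P_def)
    qed
  qed
  show tetrahedron: "tetrahedron = pauli_facets"
  proof -
    have "tetrahedron = convex hull region_points 1 1"
      unfolding tetrahedron_def by (rule arg_cong[where f = "\<lambda>S. convex hull S"])
        (auto simp: region_points_def)
    moreover have "pauli_facets \<subseteq> {v. \<bar>v$3\<bar> \<le> 1}"
      by (auto simp: pauli_facets_def)
    ultimately show ?thesis
      by (auto simp: hull)
  qed
  show "truncated_tetrahedron b = convex hull region_points 1 b" if "0 \<le> b" "b \<le> 1" for b
    using that by (simp add: truncated_tetrahedron_def tetrahedron hull)
qed

section \<open>Extreme points of the truncated tetrahedron\<close>

lemma extreme_pointI_functionals: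
  fixes w :: "'a::real_inner"
  assumes "w \<in> S"
    and max: "\<And>x. x \<in> S \<Longrightarrow> inner f x \<le> inner f w \<and> inner g x \<le> inner g w \<and> inner h x \<le> inner h w"
    and inj: "\<And>x. inner f x = inner f w \<Longrightarrow> inner g x = inner g w \<Longrightarrow> inner h x = inner h w \<Longrightarrow> x = w"
  shows "w extreme_point_of S"
  unfolding extreme_point_of_def
proof (intro conjI ballI notI)
  fix x y assume "x \<in> S" "y \<in> S" and seg: "w \<in> open_segment x y"
  obtain u where u: "0 < u" "u < 1" "w = (1 - u) *\<^sub>R x + u *\<^sub>R y" and "x \<noteq> y"
    using seg by (auto simp: in_segment)
  \<comment> \<open>The deficits of \<open>d\<close> at the two ends are nonnegative, and their
    weighted sum vanishes because \<open>w\<close> is a proper convex combination. So both ends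
    attain the maximum too, and three such functionals pin them to \<open>w\<close>.\<close>
  have "inner d x = inner d w \<and> inner d y = inner d w"
    if "inner d x \<le> inner d w" "inner d y \<le> inner d w" for d
  proof -
    have "(1 - u) * (inner d w - inner d x) + u * (inner d w - inner d y) = 0"
      unfolding u(3) inner_add_right inner_scaleR_right by (simp add: algebra_simps)
    moreover have "0 \<le> (1 - u) * (inner d w - inner d x)" "0 \<le> u * (inner d w - inner d y)"
      using that u(1,2) by simp_all
    ultimately have "(1 - u) * (inner d w - inner d x) = 0" "u * (inner d w - inner d y) = 0"
      by linarith+
    then show ?thesis
      using u(1,2) by simp
  qed
  then have "x = w" "y = w"
    using max[OF \<open>x \<in> S\<close>] max[OF \<open>y \<in> S\<close>] inj by blast+
  with \<open>x \<noteq> y\<close> show False by simp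
qed (rule assms(1))

text \<open>An extreme point of a hull belongs to the generating set. Conversely, each of the eight
  points lies on two facets of the tetrahedron and on one cutting plane. The normals
  \<open>f\<close>, \<open>g\<close>, \<open>h\<close> of these three planes are independent, so the
  argument also covers \<open>b = 0\<close> and \<open>b = 1\<close>.\<close>

lemma extreme_points_truncated_tetrahedron:
  assumes "0 \<le> b" "b \<le> 1"
  shows "{v. v extreme_point_of truncated_tetrahedron b} = region_points 1 b"
proof
  show "{v. v extreme_point_of truncated_tetrahedron b} \<subseteq> region_points 1 b"
    using assms by (auto simp: truncated_tetrahedron_eq_hull dest: extreme_point_of_convex_hull)
  have T: "truncated_tetrahedron b = pauli_facets \<inter> {v. \<bar>v$3\<bar> \<le> b}"
    by (simp add: truncated_tetrahedron_def tetrahedron_eq_facets)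
  have x_vertex: "vector [c, s * b, - (c * s) * b] extreme_point_of truncated_tetrahedron b"
    if "c \<in> {1, -1}" "s \<in> {1, -1}" for c s
    by (rule extreme_pointI_functionals[where f = "vector [c, 1, c]" and g = "vector [c, -1, -c]"
          and h = "vector [0, 0, - c * s]"])
      (use that assms in \<open>auto simp: T pauli_facets_def inner_vec_def sum_3 vec3_eq_iff\<close>)
  have y_vertex: "vector [s * b, c, - (c * s) * b] extreme_point_of truncated_tetrahedron b"
    if "c \<in> {1, -1}" "s \<in> {1, -1}" for c s
    by (rule extreme_pointI_functionals[where f = "vector [1, c, c]" and g = "vector [-1, c, -c]"
          and h = "vector [0, 0, - c * s]"])
      (use that assms in \<open>auto simp: T pauli_facets_def inner_vec_def sum_3 vec3_eq_iff\<close>)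
  show "region_points 1 b \<subseteq> {v. v extreme_point_of truncated_tetrahedron b}"
    using x_vertex[of 1 1] x_vertex[of 1 "-1"] x_vertex[of "-1" 1] x_vertex[of "-1" "-1"]
      y_vertex[of 1 1] y_vertex[of 1 "-1"] y_vertex[of "-1" 1] y_vertex[of "-1" "-1"]
    by (simp add: region_points_def)
qed

section \<open>The shrinking map\<close>

lemma
  shows linear_shrink: "linear (shrink a)"
    and region_points_eq_shrink: "region_points a b = shrink a ` region_points 1 b"
proof -
  show "linear (shrink a)"
    by (rule linearI) (simp_all add: shrink_def vec_eq_iff forall_3 algebra_simps)
  show "region_points a b = shrink a ` region_points 1 b"
    by (simp add: region_points_def shrink_def image_Un)
qed

text \<open>A facet inequality \<bar>s\<bar> \<le> 1 - z survives because (1 - a^2 z) - a (1 - z) =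
  (1 - a)(1 + a z) is nonnegative. The other pair of facets is the same estimate with -z. The main
  theorem uses this for membership of \<open>q\<close> in the tetrahedron, which it asserts even
  where \<open>param_a\<close> or \<open>param_b\<close> is meaningless.\<close>

lemma shrink_in_tetrahedron:
  assumes "0 \<le> a" "a \<le> 1" "v \<in> tetrahedron"
  shows "shrink a v \<in> tetrahedron"
proof -
  have *: "a * \<bar>s\<bar> \<le> 1 - a\<^sup>2 * z" if "\<bar>s\<bar> \<le> 1 - z" "- 1 \<le> z" for s z
  proof -
    have "a * \<bar>s\<bar> \<le> a * (1 - z)"
      using that assms by (intro mult_left_mono) auto
    moreover have "0 \<le> (1 - a) * (1 + a * z)"
    proof -
      have "a * (- 1) \<le> a * z" using that assms by (intro mult_left_mono) auto
      then show ?thesis using assms by simp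
    qed
    ultimately show ?thesis by (simp add: algebra_simps power2_eq_square)
  qed
  have "a * \<bar>v$1 + v$2\<bar> \<le> 1 - a\<^sup>2 * v$3" "a * \<bar>v$1 - v$2\<bar> \<le> 1 - a\<^sup>2 * (- (v$3))"
    using assms(3) by (intro *; auto simp: tetrahedron_eq_facets pauli_facets_def)+
  then show ?thesis
    using assms(1) by (simp add: tetrahedron_eq_facets pauli_facets_def shrink_def abs_mult
        flip: distrib_left right_diff_distrib)
qed

section \<open>Channels that are diagonal up to a shift along z\<close>

text \<open>The common shape of amplitude damping, Pauli channels and every channel simulated here.
  It is preserved by composition, by conjugation with a Pauli matrix and by mixing, so two channels
  agree as soon as their four real parameters do.\<close>

definition diag_channel :: "real \<Rightarrow> real \<Rightarrow> real \<Rightarrow> real \<Rightarrow> 2 cmat \<Rightarrow> 2 cmat" where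
  "diag_channel x y z t = bloch_channel (\<lambda>r. vector [x * r$1, y * r$2, t + z * r$3])"

lemma diag_channel_entries:
  "diag_channel x y z t M $ 1 $ 1 = ((1 + t) * (M$1$1 + M$2$2) + z * (M$1$1 - M$2$2)) / 2"
  "diag_channel x y z t M $ 2 $ 2 = ((1 - t) * (M$1$1 + M$2$2) - z * (M$1$1 - M$2$2)) / 2"
  "diag_channel x y z t M $ 1 $ 2 = (x * (M$1$2 + M$2$1) + y * (M$1$2 - M$2$1)) / 2"
  "diag_channel x y z t M $ 2 $ 1 = (x * (M$1$2 + M$2$1) - y * (M$1$2 - M$2$1)) / 2"
  by (simp_all add: diag_channel_def bloch_channel_def bloch_state_def mat2_simps field_simps)

lemma
  shows diag_channel_comp: "diag_channel x y z t \<circ> diag_channel x' y' z' t' =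
      diag_channel (x * x') (y * y') (z * z') (t + z * t')"
    and unitary_channel_pauli1_diag:
      "unitary_channel (pauli 1) \<circ> diag_channel x y z t = diag_channel x (- y) (- z) (- t)"
proof -
  \<comment> \<open>Up to a factor, these four combinations are the trace and the traces against the
    three Pauli matrices. A diagonal channel only scales and shifts them, so a composition can be
    computed without expanding the inner channel.\<close>
  have sums:
    "diag_channel x y z t M $1$1 + diag_channel x y z t M $2$2 = M$1$1 + M$2$2"
    "diag_channel x y z t M $1$1 - diag_channel x y z t M $2$2 = t * (M$1$1 + M$2$2) + z * (M$1$1 - M$2$2)"
    "diag_channel x y z t M $1$2 + diag_channel x y z t M $2$1 = x * (M$1$2 + M$2$1)"
    "diag_channel x y z t M $1$2 - diag_channel x y z t M $2$1 = y * (M$1$2 - M$2$1)" for x y z t M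
    unfolding diag_channel_entries by (simp_all add: field_simps)
  show "diag_channel x y z t \<circ> diag_channel x' y' z' t' =
      diag_channel (x * x') (y * y') (z * z') (t + z * t')"
    unfolding fun_eq_iff comp_def vec_eq_iff forall_2 diag_channel_entries[of x y z t]
      diag_channel_entries[of "x * x'"] sums
    by (simp add: algebra_simps)
  show "unitary_channel (pauli 1) \<circ> diag_channel x y z t = diag_channel x (- y) (- z) (- t)"
    by (simp add: fun_eq_iff vec_eq_iff forall_2 diag_channel_entries unitary_channel_def
        adjoint_mat_def matrix_matrix_mult_def sum_2 field_simps)
qed

lemma
  shows amplitude_damping_eq_diag:
      "amplitude_damping \<gamma> = diag_channel (sqrt (1 - \<gamma>)) (sqrt (1 - \<gamma>)) (1 - \<gamma>) \<gamma>"
    and pauli_channel_eq_diag: "pauli_channel q = diag_channel (q$1) (- (q$2)) (q$3) 0"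
  by (simp_all add: amplitude_damping_def pauli_channel_def diag_channel_def)

section \<open>Teleportation over the Choi matrix\<close>

definition pauli_sign :: "nat \<Rightarrow> nat \<Rightarrow> real" where
  "pauli_sign i l = (if l = 0 \<or> l = i then 1 else - 1)"

text \<open>Conjugation by \<open>pauli l\<close> multiplies \<open>pauli i\<close> by
  \<open>pauli_sign i l\<close>, for \<open>i\<close> from 1 to 3. Outcome \<open>k\<close> has
  weight 1/4 whatever the input. Its Pauli matrix acts before the damping and leaves the shift
  alone, while the correction \<open>l\<close> acts afterwards and changes the sign of the shift as
  well.\<close>

lemma teleport_outcome:
  assumes "k \<le> 3" "l \<le> 3"
  shows "pauli l ** trace_CA (on_CA (bell_proj k) ** tensor_mat M (choi (amplitude_damping \<gamma>))) ** pauli l =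
    (1/4) *\<^sub>R diag_channel (pauli_sign 1 l * (pauli_sign 1 k * sqrt (1 - \<gamma>)))
      (pauli_sign 2 l * (pauli_sign 2 k * sqrt (1 - \<gamma>)))
      (pauli_sign 3 l * (pauli_sign 3 k * (1 - \<gamma>))) (pauli_sign 3 l * \<gamma>) M"
proof -
  have sum_prod: "(\<Sum>i\<in>UNIV. f i) = (\<Sum>i\<in>UNIV. \<Sum>j\<in>UNIV. f (i, j))"
    for f :: "2 \<times> 'n::finite \<Rightarrow> complex"
    by (simp add: sum.cartesian_product)
  have "k = 0 \<or> k = 1 \<or> k = 2 \<or> k = 3"
    using assms(1) by auto
  then have outcome: "trace_CA (on_CA (bell_proj k) ** tensor_mat M (choi (amplitude_damping \<gamma>))) =
      (1/4) *\<^sub>R diag_channel (pauli_sign 1 k * sqrt (1 - \<gamma>)) (pauli_sign 2 k * sqrt (1 - \<gamma>))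
        (pauli_sign 3 k * (1 - \<gamma>)) \<gamma> M"
    unfolding choi_amplitude_damping
    by (elim disjE; simp add: vec_eq_iff forall_2 diag_channel_entries pauli_sign_def
          matrix_matrix_mult_def sum_2 sum_prod trace_CA_def on_CA_def bell_proj_def
          ket_bra_def tensor_mat_def axis_def numeral_2_eq_2 numeral_3_eq_3;
        simp add: scaleR_conv_of_real field_simps)
  have "l = 0 \<or> l = 1 \<or> l = 2 \<or> l = 3"
    using assms(2) by auto
  then have "pauli l ** diag_channel x y z t M ** pauli l = diag_channel (pauli_sign 1 l * x)
      (pauli_sign 2 l * y) (pauli_sign 3 l * z) (pauli_sign 3 l * t) M" for x y z t
    by (elim disjE) (simp_all add: vec_eq_iff forall_2 diag_channel_entries pauli_sign_def
        matrix_matrix_mult_def sum_2 mat_def numeral_2_eq_2 numeral_3_eq_3 field_simps)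
  then show ?thesis
    unfolding outcome by (simp add: matrix_scalar_ac flip: scalar_matrix_assoc)
qed

text \<open>The matrix entries are affine in the four parameters; the normalisation of the weights
  takes care of the constant term, which carries the trace of \<open>M\<close>.\<close>

lemma diag_channel_mixture:
  assumes "sum w A = 1"
  shows "(\<Sum>i\<in>A. w i *\<^sub>R diag_channel (x i) (y i) (z i) (t i) M) =
    diag_channel (\<Sum>i\<in>A. w i * x i) (\<Sum>i\<in>A. w i * y i) (\<Sum>i\<in>A. w i * z i) (\<Sum>i\<in>A. w i * t i) M"
proof -
  have 1: "(\<Sum>i\<in>A. complex_of_real (w i)) = 1"
    using assms by (metis of_real_1 of_real_sum)
  have 2: "(\<Sum>i\<in>A. complex_of_real (w i) * c) = c" for c
    using 1 by (simp flip: sum_distrib_right)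
  show ?thesis
    by (simp add: vec_eq_iff forall_2 diag_channel_entries)
      (simp add: scaleR_conv_of_real sum_distrib_right mult.assoc 2
        distrib_right left_diff_distrib distrib_left right_diff_distrib
        sum.distrib sum_subtractf flip: sum_divide_distrib)
qed

section \<open>Averages over the classical channel\<close>

definition correlation :: "(nat \<Rightarrow> nat \<Rightarrow> real) \<Rightarrow> nat \<Rightarrow> real" where
  "correlation p i = (\<Sum>k=0..3. \<Sum>l=0..3. p l k * (pauli_sign i l * pauli_sign i k)) / 4"

definition output_bias :: "(nat \<Rightarrow> nat \<Rightarrow> real) \<Rightarrow> real" where
  "output_bias p = (\<Sum>k=0..3. \<Sum>l=0..3. p l k * pauli_sign 3 l) / 4"

text \<open>The pairs (k, l) with weights \<open>p l k / 4\<close> form one probability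
  distribution, so the double sum is a single mixture. \<open>correlation p\<close> at 1, 2, 3 gives
  X, Y, Z, and \<open>output_bias p\<close> gives W. The latter averages the sign of
  \<open>l\<close> alone, since the shift does not depend on \<open>k\<close>.\<close>

lemma noisy_teleportation_eq_diag:
  assumes "classical_channel p"
  shows "noisy_teleportation (choi (amplitude_damping \<gamma>)) p =
    diag_channel (correlation p 1 * sqrt (1 - \<gamma>)) (correlation p 2 * sqrt (1 - \<gamma>))
      (correlation p 3 * (1 - \<gamma>)) (output_bias p * \<gamma>)"
proof
  fix M
  define A where "A = {0..3::nat} \<times> {0..3::nat}"
  define w where "w = (\<lambda>(k, l). p l k / 4)"
  define s where "s = (\<lambda>i (k, l). pauli_sign i l * pauli_sign i k)"
  define g where "g = (\<lambda>(k::nat, l). pauli_sign 3 l)"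
  have [simp]: "sum w A = 1"
    using assms by (simp add: classical_channel_def A_def w_def numeral_3_eq_3
        flip: sum.cartesian_product sum_divide_distrib)
  have "noisy_teleportation (choi (amplitude_damping \<gamma>)) p M =
    (\<Sum>k=0..3. \<Sum>l=0..3. (p l k / 4) *\<^sub>R diag_channel (s 1 (k, l) * sqrt (1 - \<gamma>))
      (s 2 (k, l) * sqrt (1 - \<gamma>)) (s 3 (k, l) * (1 - \<gamma>)) (g (k, l) * \<gamma>) M)"
    unfolding noisy_teleportation_def
    by (intro sum.cong refl) (simp add: teleport_outcome s_def g_def mult.assoc)
  also have "\<dots> = (\<Sum>i\<in>A. w i *\<^sub>R diag_channel (s 1 i * sqrt (1 - \<gamma>))
      (s 2 i * sqrt (1 - \<gamma>)) (s 3 i * (1 - \<gamma>)) (g i * \<gamma>) M)"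
    by (simp add: A_def w_def sum.cartesian_product case_prod_unfold)
  also have "\<dots> = diag_channel (correlation p 1 * sqrt (1 - \<gamma>))
      (correlation p 2 * sqrt (1 - \<gamma>)) (correlation p 3 * (1 - \<gamma>)) (output_bias p * \<gamma>) M"
  proof -
    have "(\<Sum>i\<in>A. w i * (s j i * c)) = correlation p j * c" for j c
      by (simp add: A_def w_def s_def correlation_def sum_distrib_left sum_divide_distrib
          sum.cartesian_product case_prod_unfold mult_ac)
    moreover have "(\<Sum>i\<in>A. w i * (g i * c)) = output_bias p * c" for c
      by (simp add: A_def w_def g_def output_bias_def sum_distrib_left sum_divide_distrib
          sum.cartesian_product case_prod_unfold mult_ac)
    ultimately show ?thesis
      by (simp add: diag_channel_mixture)
  qed
  finally show "noisy_teleportation (choi (amplitude_damping \<gamma>)) p M =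
    diag_channel (correlation p 1 * sqrt (1 - \<gamma>)) (correlation p 2 * sqrt (1 - \<gamma>))
      (correlation p 3 * (1 - \<gamma>)) (output_bias p * \<gamma>) M" .
qed

text \<open>For fixed \<open>k\<close> the means \<open>e 1 k\<close>, \<open>e 2 k\<close>,
  \<open>e 3 k\<close> form a point of the tetrahedron with its y axis reversed. The signs of
  outcome \<open>k\<close> flip either no axis or two axes, which is a symmetry of that tetrahedron,
  so the average over \<open>k\<close> stays inside. The first bound holds because Z + W is the mean
  of \<open>e 3 0\<close> and \<open>e 3 3\<close>, and W - Z the mean of \<open>e 3 1\<close> and
  \<open>e 3 2\<close>, all of them in [-1, 1].\<close>

lemma classical_channel_bounds:
  assumes "classical_channel p"
  shows "\<bar>correlation p 3\<bar> + \<bar>output_bias p\<bar> \<le> 1"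
    and "\<bar>correlation p 1 - correlation p 2\<bar> \<le> 1 - correlation p 3"
    and "\<bar>correlation p 1 + correlation p 2\<bar> \<le> 1 + correlation p 3"
proof -
  have sum_upto_3: "(\<Sum>k=0..3. f k) = f 0 + f 1 + f 2 + f (3::nat)" for f :: "nat \<Rightarrow> real"
    by (simp add: sum.atLeast0_atMost_Suc numeral_2_eq_2 numeral_3_eq_3)
  define e where "e i k = (\<Sum>l=0..3. p l k * pauli_sign i l)" for i k
  have e: "e 1 k = p 0 k + p 1 k - p 2 k - p 3 k" "e 2 k = p 0 k - p 1 k + p 2 k - p 3 k"
      "e 3 k = p 0 k - p 1 k - p 2 k + p 3 k" for k
    by (simp_all add: e_def pauli_sign_def sum_upto_3)
  have cor: "4 * correlation p i = pauli_sign i 0 * e i 0 + pauli_sign i 1 * e i 1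
      + pauli_sign i 2 * e i 2 + pauli_sign i 3 * e i 3" for i
    by (simp add: correlation_def e_def sum_upto_3 algebra_simps)
  have bias: "4 * output_bias p = e 3 0 + e 3 1 + e 3 2 + e 3 3"
    by (simp add: output_bias_def e_def sum_upto_3)
  \<comment> \<open>The slack of each inequality is four times one of the probabilities
    \<open>p l k\<close>.\<close>
  have facets: "e 1 k - e 2 k \<le> 1 - e 3 k" "e 2 k - e 1 k \<le> 1 - e 3 k"
      "e 1 k + e 2 k \<le> 1 + e 3 k" "- e 1 k - e 2 k \<le> 1 + e 3 k" if "k \<le> 3" for k
  proof -
    have "0 \<le> p 0 k" "0 \<le> p 1 k" "0 \<le> p 2 k" "0 \<le> p 3 k" "p 0 k + p 1 k + p 2 k + p 3 k = 1"
      using assms that by (simp_all add: classical_channel_def sum_upto_3)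
    then show "e 1 k - e 2 k \<le> 1 - e 3 k" "e 2 k - e 1 k \<le> 1 - e 3 k"
      "e 1 k + e 2 k \<le> 1 + e 3 k" "- e 1 k - e 2 k \<le> 1 + e 3 k"
      unfolding e by linarith+
  qed
  have z: "e 3 k \<le> 1" "- 1 \<le> e 3 k" if "k \<le> 3" for k
    using facets[OF that] by linarith+
  have k: "(0::nat) \<le> 3" "(1::nat) \<le> 3" "(2::nat) \<le> 3" "(3::nat) \<le> 3"
    by simp_all
  have c1: "4 * correlation p 1 = e 1 0 + e 1 1 - e 1 2 - e 1 3"
    and c2: "4 * correlation p 2 = e 2 0 - e 2 1 + e 2 2 - e 2 3"
    and c3: "4 * correlation p 3 = e 3 0 - e 3 1 - e 3 2 + e 3 3"
    unfolding cor by (simp_all add: pauli_sign_def)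
  have "correlation p 3 + output_bias p \<le> 1" "correlation p 3 - output_bias p \<le> 1"
      "- correlation p 3 + output_bias p \<le> 1" "- correlation p 3 - output_bias p \<le> 1"
    using c3 bias z[OF k(1)] z[OF k(2)] z[OF k(3)] z[OF k(4)] by linarith+
  then show "\<bar>correlation p 3\<bar> + \<bar>output_bias p\<bar> \<le> 1"
    by linarith
  show "\<bar>correlation p 1 - correlation p 2\<bar> \<le> 1 - correlation p 3"
    unfolding abs_le_iff
    using c1 c2 c3 facets[OF k(1)] facets[OF k(2)] facets[OF k(3)] facets[OF k(4)]
    by (intro conjI; linarith)
  show "\<bar>correlation p 1 + correlation p 2\<bar> \<le> 1 + correlation p 3"
    unfolding abs_le_iff
    using c1 c2 c3 facets[OF k(1)] facets[OF k(2)] facets[OF k(3)] facets[OF k(4)]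
    by (intro conjI; linarith)
qed

section \<open>Decomposition of the simulated channel\<close>

theorem theorem16:
  fixes \<gamma> :: real
  assumes "0 \<le> \<gamma>" and "\<gamma> \<le> 1"
  shows "(\<forall>p. classical_channel p \<longrightarrow>
            (\<exists>u\<in>{0, 1 :: nat}. \<exists>\<eta>\<in>{0..\<gamma>}. \<exists>q\<in>tetrahedron.
               (\<gamma> \<noteq> 0 \<and> \<eta> \<noteq> 1 \<longrightarrow>
                  q \<in> convex hull region_points (param_a \<gamma> \<eta>) (param_b \<gamma> \<eta>)) \<and>
               noisy_teleportation (choi (amplitude_damping \<gamma>)) p =
                 (unitary_channel (pauli 1) ^^ u) \<circ> amplitude_damping \<eta> \<circ> pauli_channel q))
       \<and> (\<forall>\<eta>\<in>{0..\<gamma>}. \<gamma> \<noteq> 0 \<and> \<eta> \<noteq> 1 \<longrightarrow>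
            region_points (param_a \<gamma> \<eta>) (param_b \<gamma> \<eta>) =
              shrink (param_a \<gamma> \<eta>) `
                {v. v extreme_point_of truncated_tetrahedron (param_b \<gamma> \<eta>)})"
proof (intro conjI allI impI ballI)
  fix \<eta> assume "\<eta> \<in> {0..\<gamma>}" "\<gamma> \<noteq> 0 \<and> \<eta> \<noteq> 1"
  then have "0 \<le> param_b \<gamma> \<eta>" "param_b \<gamma> \<eta> \<le> 1"
    using assms by (auto simp: param_b_def)
  then show "region_points (param_a \<gamma> \<eta>) (param_b \<gamma> \<eta>) = shrink (param_a \<gamma> \<eta>) `
      {v. v extreme_point_of truncated_tetrahedron (param_b \<gamma> \<eta>)}"
    by (simp add: extreme_points_truncated_tetrahedron region_points_eq_shrink[of "param_a \<gamma> \<eta>"])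
next
  fix p assume p: "classical_channel p"
  define X Y Z W where "X = correlation p 1" and "Y = correlation p 2"
    and "Z = correlation p 3" and "W = output_bias p"
  have bounds: "\<bar>Z\<bar> + \<bar>W\<bar> \<le> 1" "\<bar>X - Y\<bar> \<le> 1 - Z" "\<bar>X + Y\<bar> \<le> 1 + Z"
    using classical_channel_bounds[OF p] by (simp_all add: X_def Y_def Z_def W_def)
  define \<eta> where "\<eta> = \<gamma> * \<bar>W\<bar>"
  define a where "a = param_a \<gamma> \<eta>"
  define \<epsilon> :: real where "\<epsilon> = (if W < 0 then - 1 else 1)"
  define u :: nat where "u = (if W < 0 then 1 else 0)"
  \<comment> \<open>The minus sign cancels the one in \<open>pauli_channel\<close>. For
    \<open>u = 1\<close> the final conjugation flips the y and z axes, and the factor \<epsilon>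
    undoes this in advance.\<close>
  define v :: "real^3" where "v = vector [X, - \<epsilon> * Y, \<epsilon> * Z]"
  have "\<gamma> * \<bar>W\<bar> \<le> \<gamma> * 1"
    using bounds(1) assms by (intro mult_left_mono) auto
  then have \<eta>: "0 \<le> \<eta>" "\<eta> \<le> \<gamma>"
    using assms by (simp_all add: \<eta>_def)
  \<comment> \<open>Passing from \<epsilon> = 1 to \<epsilon> = -1 merely exchanges the two facet
    bounds.\<close>
  have v: "v \<in> tetrahedron" "\<bar>v$3\<bar> \<le> 1 - \<bar>W\<bar>"
    using bounds by (auto simp: v_def \<epsilon>_def tetrahedron_eq_facets pauli_facets_def)
  have a: "0 \<le> a" "a \<le> 1"
    using \<eta> assms by (auto simp: a_def param_a_def divide_le_eq_1)
  \<comment> \<open>If \<open>\<eta> = 1\<close>, then \<open>\<gamma> = 1\<close> and division by zero gives \<open>a = 0\<close>, which is the value needed.\<close>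
  have sqrt_a: "sqrt (1 - \<eta>) * a = sqrt (1 - \<gamma>)"
    using \<eta> assms by (cases "\<eta> = 1") (auto simp: a_def param_a_def real_sqrt_divide)
  \<comment> \<open>Squaring \<open>sqrt_a\<close> covers \<eta> = 1 as well, where both sides of
    \<open>a2\<close> are 0.\<close>
  have "(1 - \<eta>) * a\<^sup>2 = (sqrt (1 - \<eta>) * a)\<^sup>2"
    using \<eta> assms by (simp add: power_mult_distrib)
  then have a2: "(1 - \<eta>) * a\<^sup>2 = 1 - \<gamma>"
    using assms by (simp add: sqrt_a)
  \<comment> \<open>The choice of \<eta> makes \<open>param_b\<close> equal to 1 - \<bar>W\<bar>,
    the truncation height already known for \<open>v\<close>. A linear map commutes with convex
    hulls, so the shrunk point lies in the hull of the shrunk points.\<close>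
  have hull: "shrink a v \<in> convex hull region_points a (param_b \<gamma> \<eta>)" if "\<gamma> \<noteq> 0"
  proof -
    have "param_b \<gamma> \<eta> = 1 - \<bar>W\<bar>"
      using that by (simp add: param_b_def \<eta>_def)
    moreover have "v \<in> convex hull region_points 1 (1 - \<bar>W\<bar>)"
      using v bounds(1)
      by (subst truncated_tetrahedron_eq_hull[symmetric]) (auto simp: truncated_tetrahedron_def)
    ultimately show ?thesis
      unfolding region_points_eq_shrink[of a] convex_hull_linear_image[OF linear_shrink, symmetric]
      by simp
  qed
  have "amplitude_damping \<eta> \<circ> pauli_channel (shrink a v) =
      diag_channel (sqrt (1 - \<eta>) * a * X) (\<epsilon> * (sqrt (1 - \<eta>) * a * Y))
        (\<epsilon> * ((1 - \<eta>) * a\<^sup>2 * Z)) \<eta>"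
    by (simp add: amplitude_damping_eq_diag pauli_channel_eq_diag diag_channel_comp
        shrink_def v_def mult_ac)
  moreover have pow1: "unitary_channel (pauli 1) ^^ 1 = unitary_channel (pauli 1)"
    by (simp only: One_nat_def funpow.simps comp_id)
  ultimately have channel: "(unitary_channel (pauli 1) ^^ u) \<circ> amplitude_damping \<eta> \<circ> pauli_channel (shrink a v) =
      noisy_teleportation (choi (amplitude_damping \<gamma>)) p"
    unfolding noisy_teleportation_eq_diag[OF p] sqrt_a a2 X_def[symmetric] Y_def[symmetric]
      Z_def[symmetric] W_def[symmetric]
    by (simp add: u_def \<epsilon>_def \<eta>_def comp_assoc unitary_channel_pauli1_diag algebra_simps pow1
        del: One_nat_def)
  have "u \<in> {0, 1}" "\<eta> \<in> {0..\<gamma>}" "shrink a v \<in> tetrahedron"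
      "\<gamma> \<noteq> 0 \<and> \<eta> \<noteq> 1 \<longrightarrow>
        shrink a v \<in> convex hull region_points (param_a \<gamma> \<eta>) (param_b \<gamma> \<eta>)"
    using \<eta> hull shrink_in_tetrahedron[OF a v(1)] by (simp_all add: u_def a_def)
  with channel[symmetric]
  show "\<exists>u\<in>{0, 1 :: nat}. \<exists>\<eta>\<in>{0..\<gamma>}. \<exists>q\<in>tetrahedron.
      (\<gamma> \<noteq> 0 \<and> \<eta> \<noteq> 1 \<longrightarrow>
         q \<in> convex hull region_points (param_a \<gamma> \<eta>) (param_b \<gamma> \<eta>)) \<and>
      noisy_teleportation (choi (amplitude_damping \<gamma>)) p =
        (unitary_channel (pauli 1) ^^ u) \<circ> amplitude_damping \<eta> \<circ> pauli_channel q"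
    by blast
qed

end
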